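(* For every integer $n>2$, there is no consecutive Latin square of order $n$.
   Context: A Latin square of order $n$ is an $n\times n$ table filled with the integers $1,\dots,n$ so that each integer appears exactly once in each row and in each column. A consecutive Latin square is a Latin square in which any two orthogonally adjacent cells (horizontal or vertical neighbors) contain consecutive integers, i.e. integers differing by exactly $1$. *)

theory Defs
  imports Main
begin

(* A table of order n is a function of row and column indices in {1..n};
   its values outside that range are irrelevant. *)

definition latin_square :: "nat \<Rightarrow> (nat \<Rightarrow> nat \<Rightarrow> nat) \<Rightarrow> bool" where
  "latin_square n L \<longleftrightarrow>
     (\<forall>i\<in>{1..n}. \<forall>j\<in>{1..n}. L i j \<in> {1..n}) \<and>
     (\<forall>i\<in>{1..n}. \<forall>k\<in>{1..n}. \<exists>!j. j \<in> {1..n} \<and> L i j = k) \<and>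
     (\<forall>j\<in>{1..n}. \<forall>k\<in>{1..n}. \<exists>!i. i \<in> {1..n} \<and> L i j = k)"

(* No wrap-around: 1 and n are not consecutive when n > 2. *)

definition consecutive :: "nat \<Rightarrow> nat \<Rightarrow> bool" where
  "consecutive a b \<longleftrightarrow> b = a + 1 \<or> a = b + 1"

definition adjacent_cells :: "nat \<times> nat \<Rightarrow> nat \<times> nat \<Rightarrow> bool" where
  "adjacent_cells c d \<longleftrightarrow>
     (fst c = fst d \<and> consecutive (snd c) (snd d)) \<or>
     (snd c = snd d \<and> consecutive (fst c) (fst d))"

definition consecutive_latin_square :: "nat \<Rightarrow> (nat \<Rightarrow> nat \<Rightarrow> nat) \<Rightarrow> bool" where
  "consecutive_latin_square n L \<longleftrightarrow>
     latin_square n L \<and>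
     (\<forall>i\<in>{1..n}. \<forall>j\<in>{1..n}. \<forall>i'\<in>{1..n}. \<forall>j'\<in>{1..n}.
        adjacent_cells (i, j) (i', j') \<longrightarrow> consecutive (L i j) (L i' j'))"

end

theory Submission
  imports Defs
begin

text \<open>Each row is a walk with steps \<open>\<plusminus>1\<close> that never revisits a value, so it never turns.
  Look at the row that has \<open>2\<close> in the first column: a step down to \<open>1\<close> would force
  it back to \<open>2\<close>, and a run upwards leaves the range \<open>{1..n}\<close> at the last column.\<close>

lemma injective_walk_from_2_increases:
  fixes a :: "nat \<Rightarrow> nat"
  assumes inj: "inj_on a {1..n}"
    and pos: "\<And>j. j \<in> {1..n} \<Longrightarrow> a j \<ge> 1"
    and step: "\<And>j. j \<in> {1..n} \<Longrightarrow> Suc j \<in> {1..n} \<Longrightarrow> consecutive (a j) (a (Suc j))"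
    and start: "a 1 = 2" and "n > 2" and "1 \<le> j" "j < n"
  shows "a j = Suc j \<and> a (Suc j) = Suc (Suc j)"
  using \<open>1 \<le> j\<close> \<open>j < n\<close>
proof (induction j rule: dec_induct)
  case base
  \<comment> \<open>\<open>n > 2\<close> provides a third column. If the second value were 1, the
    third, being positive and consecutive to 1, would be 2 again, against injectivity; so the second
    is 3.\<close>
  have "consecutive (a 1) (a (Suc 1))" "consecutive (a (Suc 1)) (a (Suc (Suc 1)))"
    using \<open>n > 2\<close> by (auto intro!: step)
  moreover have "a (Suc (Suc 1)) \<noteq> a 1"
    using inj_on_contraD[OF inj, of "Suc (Suc 1)" 1] \<open>n > 2\<close> by simp
  moreover have "a (Suc (Suc 1)) \<ge> 1"
    using pos \<open>n > 2\<close> by simp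
  ultimately show ?case
    using start unfolding consecutive_def by linarith
next
  case (step j)
  \<comment> \<open>The conclusion tracks two neighbouring values to record the direction: from
    \<open>Suc (Suc j)\<close> a step down would repeat \<open>a j\<close>. Inside this case
    \<open>step\<close> names the induction facts, hence \<open>assms(3)\<close> below.\<close>
  have "consecutive (a (Suc j)) (a (Suc (Suc j)))"
    using assms(3)[of "Suc j"] step.prems by simp
  moreover have "a (Suc (Suc j)) \<noteq> a j"
    using inj_on_contraD[OF inj, of "Suc (Suc j)" j] step.hyps step.prems by simp
  ultimately show ?case
    using step.IH step.prems unfolding consecutive_def by linarith
qed

theorem theorem5:
  fixes n :: nat
  assumes "n > 2"
  shows "\<not> (\<exists>L. consecutive_latin_square n L)"
proof
  assume "\<exists>L. consecutive_latin_square n L"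
  then obtain L where L: "consecutive_latin_square n L" ..
  then have range: "\<forall>i\<in>{1..n}. \<forall>j\<in>{1..n}. L i j \<in> {1..n}"
    and row: "\<forall>i\<in>{1..n}. \<forall>k\<in>{1..n}. \<exists>!j. j \<in> {1..n} \<and> L i j = k"
    and col: "\<forall>j\<in>{1..n}. \<forall>k\<in>{1..n}. \<exists>!i. i \<in> {1..n} \<and> L i j = k"
    and adj: "\<forall>i\<in>{1..n}. \<forall>j\<in>{1..n}. \<forall>i'\<in>{1..n}. \<forall>j'\<in>{1..n}.
        adjacent_cells (i, j) (i', j') \<longrightarrow> consecutive (L i j) (L i' j')"
    unfolding consecutive_latin_square_def latin_square_def by - (elim conjE, assumption)+
  have "1 \<in> {1..n}" "2 \<in> {1..n}"
    using assms by auto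
  then have "\<exists>!i. i \<in> {1..n} \<and> L i 1 = 2"
    by (rule col[rule_format])
  then obtain i where i: "i \<in> {1..n}" "L i 1 = 2"
    by blast
  have "inj_on (L i) {1..n}"
  proof (rule inj_onI)
    fix j j' assume "j \<in> {1..n}" "j' \<in> {1..n}" "L i j = L i j'"
    \<comment> \<open>By \<open>range\<close>, the shared value \<open>L i j\<close> is a legitimate
      \<open>k\<close> for \<open>row\<close>.\<close>
    moreover from this have "\<exists>!j''. j'' \<in> {1..n} \<and> L i j'' = L i j"
      using range i(1) by (intro row[rule_format]) auto
    ultimately show "j = j'"
      by metis
  qed
  moreover have "L i j \<ge> 1" if "j \<in> {1..n}" for j
    using range i(1) that by auto
  moreover have "consecutive (L i j) (L i (Suc j))"
    if "j \<in> {1..n}" "Suc j \<in> {1..n}" for j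
  proof -
    have "adjacent_cells (i, j) (i, Suc j)"
      by (simp add: adjacent_cells_def consecutive_def)
    with i(1) that show ?thesis
      by (intro adj[rule_format])
  qed
  \<comment> \<open>The second conjunct at the last admissible index \<open>n - 1\<close> puts the
    value \<open>n + 1\<close> in column \<open>n\<close>.\<close>
  ultimately have "L i (Suc (n - 1)) = Suc (Suc (n - 1))"
    using injective_walk_from_2_increases[of "L i" n "n - 1"] i(2) assms by simp
  then show False
    using range[rule_format, OF i(1), of n] assms by simp
qed

end
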